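(* Let $G=K_9-\{16,37,49\}$ be the graph on vertex set $\{1,\dots,9\}$ whose edges are all the elements of $\binom{[9]}{2}$ except $\{1,6\}$, $\{3,7\}$ and $\{4,9\}$. Then $G$ is a $3$-triangulation of the $9$-gon, but it is a circuit in the cofactor rigidity matroid $\mathcal{C}_6(\mathbf q)$ if the position $\mathbf q=(q_1,\dots,q_9)$ of the vertices in $\mathbb{R}^2$ makes the line through $q_1,q_6$, the line through $q_3,q_7$ and the line through $q_4,q_9$ concurrent. This occurs, for example, if we take the points $q_i=(t_i,t_i^2)$ along the parabola with $t_i=i$ for $i=1,\dots,9$.
   Context: Two disjoint edges $\{i,j\},\{a,b\}\in\binom{[n]}{2}$ with $i<j$, $a<b$ cross if $i<a<j<b$ or $a<i<b<j$. A $k$-triangulation of the $n$-gon is an inclusion-maximal subset of $\binom{[n]}{2}$ containing no $k+1$ pairwise crossing edges. For $\mathbf q=(q_1,\dots,q_n)$ with $q_i=(x_i,y_i)\in\mathbb{R}^2$ and $d\ge1$, the cofactor rigidity matrix $C_d(\mathbf q)$ has one row per edge $\{i,j\}$, $i<j$, and one block of $d$ columns per vertex; the row of $\{i,j\}$ has $\mathbf c_{ij}$ in block $i$, $-\mathbf c_{ij}$ in block $j$ and zeros elsewhere, where $\mathbf c_{ij}=\big((x_i-x_j)^{d-1},(y_i-y_j)(x_i-x_j)^{d-2},\dots,(y_i-y_j)^{d-1}\big)$. $\mathcal{C}_d(\mathbf q)$ is the linear matroid of its rows, on ground set $\binom{[n]}{2}$; a circuit is a minimal linearly dependent set of rows.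
   Formalization: The circuit claim is false for arbitrary q (e.g. all points collinear); it is stated for q with no three points collinear and the common point of the three lines on no line spanned by an edge of G, and for q the vertices in order of a strictly convex 9-gon. *)

theory Defs
  imports "HOL-Analysis.Analysis"
begin

definition complete_edges :: "nat \<Rightarrow> nat set set" where
  "complete_edges n = {e. e \<subseteq> {1..n} \<and> card e = 2}"

definition crossing :: "nat set \<Rightarrow> nat set \<Rightarrow> bool" where
  "crossing e f \<longleftrightarrow>
    (\<exists>i j a b. i < j \<and> a < b \<and> e = {i, j} \<and> f = {a, b} \<and>
       (i < a \<and> a < j \<and> j < b \<or> a < i \<and> i < b \<and> b < j))"

definition crossing_free :: "nat \<Rightarrow> nat set set \<Rightarrow> bool" where
  "crossing_free m E \<longleftrightarrow>
    (\<nexists>F. F \<subseteq> E \<and> card F = m \<and> (\<forall>e\<in>F. \<forall>f\<in>F. e \<noteq> f \<longrightarrow> crossing e f))"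

definition k_triangulation :: "nat \<Rightarrow> nat \<Rightarrow> nat set set \<Rightarrow> bool" where
  "k_triangulation k n E \<longleftrightarrow>
    E \<subseteq> complete_edges n \<and> crossing_free (k + 1) E \<and>
    (\<forall>E'. E \<subset> E' \<and> E' \<subseteq> complete_edges n \<longrightarrow> \<not> crossing_free (k + 1) E')"

definition cofactor_vector ::
  "nat \<Rightarrow> (nat \<Rightarrow> real \<times> real) \<Rightarrow> nat \<Rightarrow> nat \<Rightarrow> nat \<Rightarrow> real" where
  "cofactor_vector d q i j m =
    (snd (q i) - snd (q j)) ^ m * (fst (q i) - fst (q j)) ^ (d - 1 - m)"

text \<open>Rows are indexed by edges, columns by pairs \<open>(v, m)\<close>: coordinate \<open>m < d\<close> in the
  block of vertex \<open>v\<close>. In the row of \<open>{i, j}\<close> with \<open>i < j\<close>, \<open>i\<close> is \<open>Min e\<close> and \<open>j\<close> is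
  \<open>Max e\<close>.\<close>

definition cofactor_matrix ::
  "nat \<Rightarrow> (nat \<Rightarrow> real \<times> real) \<Rightarrow> nat set \<Rightarrow> nat \<times> nat \<Rightarrow> real" where
  "cofactor_matrix d q e = (\<lambda>(v, m).
     if v = Min e then cofactor_vector d q (Min e) (Max e) m
     else if v = Max e then - cofactor_vector d q (Min e) (Max e) m
     else 0)"

text \<open>Dependence is that of the family of rows indexed by \<open>S\<close>, so two edges with equal rows
  are dependent.\<close>

definition cofactor_dependent ::
  "nat \<Rightarrow> nat \<Rightarrow> (nat \<Rightarrow> real \<times> real) \<Rightarrow> nat set set \<Rightarrow> bool" where
  "cofactor_dependent n d q S \<longleftrightarrow>
    (\<exists>w. (\<exists>e\<in>S. w e \<noteq> 0) \<and>
       (\<forall>c\<in>{1..n} \<times> {..<d}. (\<Sum>e\<in>S. w e * cofactor_matrix d q e c) = 0))"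

definition cofactor_circuit ::
  "nat \<Rightarrow> nat \<Rightarrow> (nat \<Rightarrow> real \<times> real) \<Rightarrow> nat set set \<Rightarrow> bool" where
  "cofactor_circuit n d q S \<longleftrightarrow>
    S \<subseteq> complete_edges n \<and> cofactor_dependent n d q S \<and>
    (\<forall>T. T \<subset> S \<longrightarrow> \<not> cofactor_dependent n d q T)"

definition edge_line :: "(nat \<Rightarrow> real \<times> real) \<Rightarrow> nat set \<Rightarrow> (real \<times> real) set" where
  "edge_line q e = affine hull (q ` e)"

text \<open>Concurrency of the three lines alone does not make \<open>G\<close> (below) a circuit. When all points
  are collinear the matrix has rank at most 8. When no three are collinear but a fourth line
  \<open>q\<^sub>i q\<^sub>j\<close> passes through the common point, the stress supported on \<open>G\<close> vanishes on \<open>{i, j}\<close>.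
  Hence the two nondegeneracy conditions below; under strict convexity, in cyclic order, no
  fourth line can pass through that point.\<close>

definition general_position :: "nat \<Rightarrow> (nat \<Rightarrow> real \<times> real) \<Rightarrow> bool" where
  "general_position n q \<longleftrightarrow>
    (\<forall>i\<in>{1..n}. \<forall>j\<in>{1..n}. \<forall>k\<in>{1..n}.
       i \<noteq> j \<and> j \<noteq> k \<and> i \<noteq> k \<longrightarrow> \<not> collinear {q i, q j, q k})"

definition orientation :: "real \<times> real \<Rightarrow> real \<times> real \<Rightarrow> real \<times> real \<Rightarrow> real" where
  "orientation a b c =
    (fst b - fst a) * (snd c - snd a) - (snd b - snd a) * (fst c - fst a)"

text \<open>\<open>q 1, \<dots>, q n\<close> are, in this cyclic order (clockwise or counterclockwise), the vertices
  of a strictly convex \<open>n\<close>-gon.\<close>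

definition convex_polygon :: "nat \<Rightarrow> (nat \<Rightarrow> real \<times> real) \<Rightarrow> bool" where
  "convex_polygon n q \<longleftrightarrow>
    (\<forall>i j k. 1 \<le> i \<and> i < j \<and> j < k \<and> k \<le> n \<longrightarrow> orientation (q i) (q j) (q k) > 0) \<or>
    (\<forall>i j k. 1 \<le> i \<and> i < j \<and> j < k \<and> k \<le> n \<longrightarrow> orientation (q i) (q j) (q k) < 0)"

definition missing_edges :: "nat set set" where
  "missing_edges = {{1, 6}, {3, 7}, {4, 9}}"

definition G :: "nat set set" where
  "G = complete_edges 9 - missing_edges"

end

theory Submission
  imports Defs
begin

text \<open>
  Write \<open>[i j k]\<close> for the orientation determinant of \<open>q\<^sub>i, q\<^sub>j, q\<^sub>k\<close> and let the points be in general
  position. Put \<open>d = n - 3\<close>, so that \<open>d = 6\<close> for \<open>n = 9\<close>. At a vertex \<open>i\<close> the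
  \<open>n - 1 = d + 2\<close> vectors \<open>c\<^sub>i\<^sub>j\<close> lie on the cone over the rational normal curve in dimension \<open>d\<close>.
  The dependences between such vectors form a plane and are explicit: the coefficient of \<open>c\<^sub>i\<^sub>j\<close> is
  \<open>g\<^sub>i(q\<^sub>j - q\<^sub>i) / P\<^sub>i\<^sub>j\<close>, where \<open>g\<^sub>i\<close> is an arbitrary linear form and
  \<open>P\<^sub>i\<^sub>j = \<Prod>\<^sub>k [i j k]\<close>, the product being over the vertices \<open>k\<close> other than \<open>i\<close> and \<open>j\<close>. That these
  are dependences is the identity \<open>sum_linear_forms_over_wedges_eq_0\<close>; that there are no others is
  \<open>three_term_relation\<close>.

  A stress of \<open>K\<^sub>n\<close> is a choice of the forms \<open>g\<^sub>i\<close> for which the two ends of each edge agree on its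
  weight, and the signs work out so that this reads \<open>(g\<^sub>i - g\<^sub>j)(q\<^sub>j - q\<^sub>i) = 0\<close>. This is the equation
  for infinitesimal motions, turned by a right angle, of \<open>K\<^sub>n\<close> as a bar framework in the plane. As \<open>K\<^sub>n\<close> is
  rigid (\<open>triangle_rigid\<close>), the stresses form a space of dimension three, and those that come from
  rotations are the multiples of \<open>[p i j] / P\<^sub>i\<^sub>j\<close> where \<open>p\<close> is the centre of rotation. The weight
  of an edge in such a stress vanishes exactly when the line of the edge passes through \<open>p\<close>.

  Hence, if \<open>p\<close> lies on the lines of the missing edges and on no other line, the stress with
  centre \<open>p\<close> is supported on exactly the remaining edges. Moreover a stress that vanishes on two
  disjoint missing edges is a multiple of this one (\<open>stress_eq_multiple\<close>), because the lines of the
  two edges meet only in \<open>p\<close>. So the remaining edges form a circuit (\<open>circuit_of_concurrent_lines\<close>).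

  In a strictly convex 9-gon the three missing edges cross pairwise, so \<open>p\<close> is interior to all
  three segments. An edge that shares an endpoint with one of them meets its line only in that
  endpoint. The remaining edges are \<open>25\<close>, \<open>28\<close> and \<open>58\<close>, and each of them leaves one of the three
  segments strictly on one side.

  The combinatorial part rests on the shape of four pairwise crossing edges: they join the first
  four of their endpoints to the last four in order. With nine vertices one vertex is left out,
  so there are nine such families. Each of them uses a missing edge, and each missing edge is the only
  missing edge in some family.
\<close>

section \<open>Collinearity and orientation in the plane\<close>

lemma orientation_rotate: "orientation a b c = orientation b c a"
  by (simp add: orientation_def algebra_simps)

lemma orientation_swap: "orientation a b c = - orientation a c b"
  by (simp add: orientation_def algebra_simps)

definition wedge :: "real \<times> real \<Rightarrow> real \<times> real \<Rightarrow> real" where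
  "wedge u v = fst u * snd v - snd u * fst v"

lemma wedge_commute: "wedge v u = - wedge u v"
  by (simp add: wedge_def)

lemma orientation_wedge: "orientation a b c = wedge (a - b) (a - c)"
  by (simp add: wedge_def orientation_def algebra_simps)

lemma affine_hull_pair_iff:
  assumes "a \<noteq> b"
  shows "p \<in> affine hull {a, b} \<longleftrightarrow> orientation p a b = 0"
proof
  assume "p \<in> affine hull {a, b}"
  then obtain t where "p = a + t *\<^sub>R (b - a)"
    by (auto simp: affine_hull_2_alt)
  then have "fst p = fst a + t * (fst b - fst a)" "snd p = snd a + t * (snd b - snd a)"
    by simp_all
  then show "orientation p a b = 0"
    unfolding orientation_def by algebra
next
  assume "orientation p a b = 0"
  then have eq: "(fst p - fst a) * (snd b - snd a) = (snd p - snd a) * (fst b - fst a)"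
    by (simp add: orientation_def algebra_simps)
  consider "fst b - fst a \<noteq> 0" | "snd b - snd a \<noteq> 0"
    using assms by (auto simp: prod_eq_iff)
  then have "\<exists>t. p = a + t *\<^sub>R (b - a)"
  proof cases
    case 1
    then show ?thesis
      by (intro exI[of _ "(fst p - fst a) / (fst b - fst a)"]) (simp add: prod_eq_iff eq)
  next
    case 2
    then show ?thesis
      by (intro exI[of _ "(snd p - snd a) / (snd b - snd a)"]) (simp add: prod_eq_iff flip: eq)
  qed
  then show "p \<in> affine hull {a, b}"
    by (auto simp: affine_hull_2_alt)
qed

lemma collinear_iff_orientation: "collinear {a, b, c} \<longleftrightarrow> orientation a b c = 0"
proof (cases "a = b")
  case True
  then show ?thesis by (simp add: orientation_def)
next
  case False
  have "orientation c a b = orientation a b c"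
    by (simp add: orientation_def algebra_simps)
  then show ?thesis
    using False by (simp add: collinear_3_affine_hull affine_hull_pair_iff)
qed

lemma general_position_iff:
  "general_position n q \<longleftrightarrow>
    (\<forall>i\<in>{1..n}. \<forall>j\<in>{1..n}. \<forall>k\<in>{1..n}.
       i \<noteq> j \<and> j \<noteq> k \<and> i \<noteq> k \<longrightarrow> orientation (q i) (q j) (q k) \<noteq> 0)"
  by (simp add: general_position_def collinear_iff_orientation)

lemma edge_line_iff:
  assumes "general_position n q" "3 \<le> n" "i \<in> {1..n}" "j \<in> {1..n}" "i \<noteq> j"
  shows "p \<in> edge_line q {i, j} \<longleftrightarrow> orientation p (q i) (q j) = 0"
proof -
  have "card {i, j} < card {1..n}"
    using assms(2,5) by simp
  then obtain k where "k \<in> {1..n}" "k \<notin> {i, j}"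
    by (meson card_mono finite.emptyI finite_insert not_le subsetI)
  then have "orientation (q i) (q j) (q k) \<noteq> 0"
    using assms unfolding general_position_iff by auto
  then have "q i \<noteq> q j"
    by (auto simp: orientation_def)
  then show ?thesis
    by (simp add: edge_line_def affine_hull_pair_iff)
qed

text \<open>
  Cramer's rule: the two lines through \<open>a\<close> are distinct, so they meet only in \<open>a\<close>.
\<close>

lemma meet_at_common_point:
  assumes "orientation a b c \<noteq> 0" "orientation p a b = 0" "orientation p a c = 0"
  shows "p = a"
proof -
  have "orientation a b c * (fst p - fst a)
      = orientation p a b * (fst c - fst a) - orientation p a c * (fst b - fst a)"
    "orientation a b c * (snd p - snd a)
      = orientation p a b * (snd c - snd a) - orientation p a c * (snd b - snd a)"
    unfolding orientation_def by (algebra)+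
  then show ?thesis
    using assms by (simp add: prod_eq_iff)
qed

section \<open>Linear dependences between powers of linear forms\<close>

text \<open>
  Any two independent vectors \<open>a\<close>, \<open>b\<close> give a basis \<open>wedge _ a\<close>, \<open>wedge _ b\<close> of the linear forms
  on the plane. This is the expansion of \<open>f\<close> in that basis, with the denominator cleared.
\<close>

lemma linear_form_wedge:
  fixes f :: "real \<times> real \<Rightarrow> real"
  assumes "linear f"
  shows "wedge a b * f v = f a * wedge v b - f b * wedge v a"
proof -
  have f: "f x = fst x * f (1, 0) + snd x * f (0, 1)" for x
  proof -
    have "x = fst x *\<^sub>R (1, 0) + snd x *\<^sub>R (0, 1)"
      by (simp add: prod_eq_iff)
    then have "f x = f (fst x *\<^sub>R (1, 0) + snd x *\<^sub>R (0, 1))"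
      by simp
    also have "\<dots> = fst x * f (1, 0) + snd x * f (0, 1)"
      by (simp only: linear_add[OF assms] linear_scale[OF assms] real_scaleR_def)
    finally show ?thesis .
  qed
  show ?thesis
    unfolding f[of v] f[of a] f[of b] wedge_def by algebra
qed

text \<open>
  The homogeneous form of the Lagrange identity that the top divided difference of a
  polynomial of too small a degree is zero. One of the linear forms is expanded in terms of \<open>wedge _ (u a)\<close> and
  \<open>wedge _ (u b)\<close>; each of these two factors cancels one factor of every denominator and kills the
  summand of \<open>a\<close> or \<open>b\<close>, which leaves the same identity with one point and one form fewer.
\<close>

lemma sum_linear_forms_over_wedges_eq_0:
  fixes u :: "'a \<Rightarrow> real \<times> real"
  assumes "finite J" "card J = length fs + 2" "\<forall>f\<in>set fs. linear f"
    and "\<forall>j\<in>J. \<forall>k\<in>J. j \<noteq> k \<longrightarrow> wedge (u j) (u k) \<noteq> 0"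
  shows "(\<Sum>j\<in>J. (\<Prod>f\<leftarrow>fs. f (u j)) / (\<Prod>k\<in>J - {j}. wedge (u j) (u k))) = 0"
  using assms
proof (induction fs arbitrary: J)
  case Nil
  then obtain a b where J: "J = {a, b}" "a \<noteq> b"
    by (auto simp: card_2_iff numeral_2_eq_2[symmetric])
  have "{a, b} - {a} = {b}" "{a, b} - {b} = {a}"
    using J(2) by auto
  then show ?case
    using J by (simp add: wedge_commute[of "u b" "u a"])
next
  case (Cons f fs)
  obtain a b where ab: "a \<in> J" "b \<in> J" "a \<noteq> b"
  proof -
    have "\<not> card J \<le> Suc 0"
      using Cons.prems by simp
    then show ?thesis
      using that card_le_Suc0_iff_eq[OF Cons.prems(1)] by blast
  qed
  let ?P = "\<lambda>J j. \<Prod>k\<in>J - {j}. wedge (u j) (u k)"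
  let ?h = "\<lambda>j. \<Prod>f\<leftarrow>fs. f (u j)"
  have drop: "(\<Sum>j\<in>J. wedge (u j) (u c) * (?h j / ?P J j)) = 0" if "c \<in> J" for c
  proof -
    have "(\<Sum>j\<in>J. wedge (u j) (u c) * (?h j / ?P J j))
      = (\<Sum>j\<in>J - {c}. wedge (u j) (u c) * (?h j / ?P J j))"
      using that Cons.prems(1) by (subst sum.remove[of J c]) (auto simp: wedge_def)
    also have "\<dots> = (\<Sum>j\<in>J - {c}. ?h j / ?P (J - {c}) j)"
    proof (rule sum.cong[OF refl])
      fix j assume j: "j \<in> J - {c}"
      have "?P J j = wedge (u j) (u c) * (\<Prod>k\<in>J - {j} - {c}. wedge (u j) (u k))"
        using that j Cons.prems(1) by (intro prod.remove) auto
      moreover have "J - {j} - {c} = J - {c} - {j}"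
        by auto
      moreover have "wedge (u j) (u c) \<noteq> 0"
        using that j Cons.prems(4) by auto
      ultimately show "wedge (u j) (u c) * (?h j / ?P J j) = ?h j / ?P (J - {c}) j"
        by simp
    qed
    also have "\<dots> = 0"
      using that Cons.prems by (intro Cons.IH) auto
    finally show ?thesis .
  qed
  have lin: "linear f"
    using Cons.prems(3) by simp
  have "wedge (u a) (u b) * (\<Sum>j\<in>J. f (u j) * ?h j / ?P J j)
    = (\<Sum>j\<in>J. (wedge (u a) (u b) * f (u j)) * (?h j / ?P J j))"
    by (simp add: sum_distrib_left mult.assoc)
  also have "\<dots> = (\<Sum>j\<in>J. f (u a) * (wedge (u j) (u b) * (?h j / ?P J j))
      - f (u b) * (wedge (u j) (u a) * (?h j / ?P J j)))"
    by (intro sum.cong refl) (simp only: linear_form_wedge[OF lin] left_diff_distrib mult.assoc)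
  also have "\<dots> = 0"
    by (simp only: sum_subtractf sum_distrib_left[symmetric] drop[OF ab(1)] drop[OF ab(2)] mult_zero_right diff_self)
  finally have "(\<Sum>j\<in>J. f (u j) * ?h j / ?P J j) = 0"
    using Cons.prems(4) ab by auto
  then show ?case
    by simp
qed

text \<open>
  The product of the forms \<open>wedge _ (v k)\<close> is a combination of the monomials of degree \<open>card K\<close>,
  so a dependence between the vectors of monomials annihilates it. Induction on \<open>K\<close> with one
  factor moved into the coefficients avoids writing down the expansion.
\<close>

lemma sum_prod_wedge_eq_0:
  fixes u :: "'a \<Rightarrow> real \<times> real" and v :: "'b \<Rightarrow> real \<times> real"
  assumes "finite K"
    and "\<And>m. m \<le> card K \<Longrightarrow> (\<Sum>j\<in>J. c j * (snd (u j) ^ m * fst (u j) ^ (card K - m))) = 0"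
  shows "(\<Sum>j\<in>J. c j * (\<Prod>k\<in>K. wedge (u j) (v k))) = 0"
  using assms
proof (induction K arbitrary: c rule: finite_induct)
  case empty
  then show ?case by (simp add: empty[of 0, simplified])
next
  case (insert a K)
  have "(\<Sum>j\<in>J. (c j * wedge (u j) (v a)) * (\<Prod>k\<in>K. wedge (u j) (v k))) = 0"
  proof (rule insert.IH)
    fix m assume m: "m \<le> card K"
    have "(\<Sum>j\<in>J. c j * wedge (u j) (v a) * (snd (u j) ^ m * fst (u j) ^ (card K - m)))
      = (\<Sum>j\<in>J. snd (v a) * (c j * (snd (u j) ^ m * fst (u j) ^ (Suc (card K) - m)))
           - fst (v a) * (c j * (snd (u j) ^ Suc m * fst (u j) ^ (Suc (card K) - Suc m))))"
      using m by (intro sum.cong refl) (simp add: wedge_def Suc_diff_le algebra_simps)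
    also have "\<dots> = 0"
      using insert.prems[of m] insert.prems[of "Suc m"] m insert.hyps
      by (simp add: sum_subtractf sum_distrib_left[symmetric])
    finally show "(\<Sum>j\<in>J. c j * wedge (u j) (v a)
      * (snd (u j) ^ m * fst (u j) ^ (card K - m))) = 0" .
  qed
  then show ?case
    using insert.hyps by (simp add: mult.assoc)
qed

text \<open>
  The dependence is tested against the product of the \<open>d - 1\<close> forms \<open>wedge _ (u k)\<close> with \<open>k\<close>
  different from \<open>a\<close>, \<open>b\<close> and \<open>e\<close>, so that only these three summands survive. The resulting relation
  says that \<open>\<mu>\<close> is the restriction to the vectors \<open>u j\<close> of a linear form on the plane.
\<close>

lemma three_term_relation:
  fixes u :: "'a \<Rightarrow> real \<times> real"
  assumes "finite J" and card: "card J = d + 2" and d: "1 \<le> d"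
    and gen: "\<And>j k. j \<in> J \<Longrightarrow> k \<in> J \<Longrightarrow> j \<noteq> k \<Longrightarrow> wedge (u j) (u k) \<noteq> 0"
    and eq: "\<And>m. m < d \<Longrightarrow> (\<Sum>j\<in>J. c j * (snd (u j) ^ m * fst (u j) ^ (d - 1 - m))) = 0"
    and abe: "a \<in> J" "b \<in> J" "e \<in> J" "a \<noteq> b" "b \<noteq> e" "a \<noteq> e"
  defines "\<mu> \<equiv> \<lambda>j. c j * (\<Prod>k\<in>J - {j}. wedge (u j) (u k))"
  shows "\<mu> a * wedge (u b) (u e) + \<mu> b * wedge (u e) (u a) + \<mu> e * wedge (u a) (u b) = 0"
proof -
  define K where "K = J - {a, b, e}"
  define Q where "Q j = (\<Prod>k\<in>K. wedge (u j) (u k))" for j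
  have K: "finite K" "a \<notin> K" "b \<notin> K" "e \<notin> K" "card K = d - 1"
    using assms(1) card abe by (auto simp: K_def card_Diff_subset)
  have "(\<Sum>j\<in>J. c j * Q j) = 0"
    unfolding Q_def using K(1,5) d eq by (intro sum_prod_wedge_eq_0) auto
  moreover have "Q j = 0" if "j \<in> J - {a, b, e}" for j
    unfolding Q_def using that K(1) by (intro prod_zero bexI[of _ j]) (auto simp: K_def wedge_def)
  then have "(\<Sum>j\<in>J. c j * Q j) = (\<Sum>j\<in>{a, b, e}. c j * Q j)"
    using assms(1) abe by (intro sum.mono_neutral_right) auto
  ultimately have Q: "c a * Q a + c b * Q b + c e * Q e = 0"
    using abe by simp
  have J: "J - {a} = insert b (insert e K)" "J - {b} = insert a (insert e K)"
    "J - {e} = insert a (insert b K)"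
    using abe by (auto simp: K_def)
  have m: "\<mu> a = c a * (wedge (u a) (u b) * (wedge (u a) (u e) * Q a))"
    "\<mu> b = c b * (wedge (u b) (u a) * (wedge (u b) (u e) * Q b))"
    "\<mu> e = c e * (wedge (u e) (u a) * (wedge (u e) (u b) * Q e))"
    using K abe by (simp_all add: \<mu>_def J Q_def)
  have "\<mu> a * wedge (u b) (u e) + \<mu> b * wedge (u e) (u a) + \<mu> e * wedge (u a) (u b)
     = - (wedge (u a) (u b) * wedge (u b) (u e) * wedge (u e) (u a))
       * (c a * Q a + c b * Q b + c e * Q e)"
    unfolding m wedge_commute[of "u e" "u a"] wedge_commute[of "u b" "u a"]
      wedge_commute[of "u e" "u b"] by algebra
  then show ?thesis
    by (simp add: Q)
qed

section \<open>Stresses of the complete graph\<close>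

lemma complete_edgesE:
  assumes "e \<in> complete_edges n"
  obtains i j where "e = {i, j}" "i < j" "i \<in> {1..n}" "j \<in> {1..n}"
    "Min e = i" "Max e = j"
proof -
  obtain a b where ab: "e = {a, b}" "a \<noteq> b" "a \<in> {1..n}" "b \<in> {1..n}"
    using assms by (auto simp: complete_edges_def card_2_iff)
  show thesis
  proof (cases "a < b")
    case True
    then show ?thesis using ab that[of a b] by auto
  next
    case False
    then show ?thesis using ab that[of b a] by (auto simp: insert_commute)
  qed
qed

text \<open>
  A stress has a coefficient on every edge of \<open>K\<^sub>n\<close>, so that dependences of different edge
  sets become elements of one space, distinguished by their supports.
\<close>

definition stress :: "nat \<Rightarrow> nat \<Rightarrow> (nat \<Rightarrow> real \<times> real) \<Rightarrow> (nat set \<Rightarrow> real) \<Rightarrow> bool" where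
  "stress n d q w \<longleftrightarrow>
    (\<forall>c\<in>{1..n} \<times> {..<d}. (\<Sum>e\<in>complete_edges n. w e * cofactor_matrix d q e c) = 0)"

lemma finite_complete_edges: "finite (complete_edges n)"
  by (rule finite_subset[of _ "Pow {1..n}"]) (auto simp: complete_edges_def)

lemma doubleton_complete_edges:
  "i \<in> {1..n} \<Longrightarrow> j \<in> {1..n} \<Longrightarrow> i \<noteq> j \<Longrightarrow> {i, j} \<in> complete_edges n"
  by (simp add: complete_edges_def)

lemma cofactor_dependent_iff_stress:
  assumes "S \<subseteq> complete_edges n"
  shows "cofactor_dependent n d q S \<longleftrightarrow>
    (\<exists>w. stress n d q w \<and> (\<exists>e\<in>S. w e \<noteq> 0) \<and> (\<forall>e\<in>complete_edges n - S. w e = 0))"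
proof -
  have sum: "(\<Sum>e\<in>complete_edges n. w e * cofactor_matrix d q e c)
      = (\<Sum>e\<in>S. w e * cofactor_matrix d q e c)"
    if "\<forall>e\<in>complete_edges n - S. w e = 0" for w c
    using assms that by (intro sum.mono_neutral_right finite_complete_edges) auto
  show ?thesis
  proof
    assume "cofactor_dependent n d q S"
    then obtain w where w: "\<exists>e\<in>S. w e \<noteq> 0"
      "\<forall>c\<in>{1..n} \<times> {..<d}. (\<Sum>e\<in>S. w e * cofactor_matrix d q e c) = 0"
      by (auto simp: cofactor_dependent_def)
    define w' where "w' e = (if e \<in> S then w e else 0)" for e
    have off: "\<forall>e\<in>complete_edges n - S. w' e = 0"
      by (simp add: w'_def)
    have "(\<Sum>e\<in>S. w' e * cofactor_matrix d q e c) = (\<Sum>e\<in>S. w e * cofactor_matrix d q e c)" for c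
      by (intro sum.cong) (simp_all add: w'_def)
    then have "stress n d q w'"
      using w(2) unfolding stress_def sum[OF off] by simp
    moreover have "\<exists>e\<in>S. w' e \<noteq> 0"
      using w(1) by (simp add: w'_def)
    ultimately show "\<exists>w. stress n d q w \<and> (\<exists>e\<in>S. w e \<noteq> 0) \<and> (\<forall>e\<in>complete_edges n - S. w e = 0)"
      using off by blast
  next
    assume "\<exists>w. stress n d q w \<and> (\<exists>e\<in>S. w e \<noteq> 0) \<and> (\<forall>e\<in>complete_edges n - S. w e = 0)"
    then obtain w where w: "stress n d q w" "\<exists>e\<in>S. w e \<noteq> 0"
      "\<forall>e\<in>complete_edges n - S. w e = 0"
      by blast
    then show "cofactor_dependent n d q S"
      using w(1,2) unfolding stress_def cofactor_dependent_def sum[OF w(3)] by blast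
  qed
qed

text \<open>
  A row has \<open>c\<^sub>i\<^sub>j\<close> in the block of its smaller vertex \<open>i\<close> and \<open>- c\<^sub>i\<^sub>j = (-1)\<^sup>d c\<^sub>j\<^sub>i\<close> in that of
  its larger vertex \<open>j\<close>. With this sign both blocks have the same form as seen from their own vertex.
\<close>

definition block_sign :: "nat \<Rightarrow> nat \<Rightarrow> nat \<Rightarrow> real" where
  "block_sign d v j = (if v < j then 1 else (-1) ^ d)"

lemma cofactor_matrix_incident:
  assumes "m < d" "v \<noteq> j"
  shows "cofactor_matrix d q {v, j} (v, m)
    = block_sign d v j * (snd (q v - q j) ^ m * fst (q v - q j) ^ (d - 1 - m))"
proof (cases "v < j")
  case True
  then show ?thesis
    by (simp add: cofactor_matrix_def cofactor_vector_def block_sign_def)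
next
  case False
  then have "j < v"
    using assms(2) by simp
  moreover have "- ((b - a) ^ m * (y - x) ^ (d - 1 - m))
      = (-1) ^ d * ((a - b) ^ m * (x - y) ^ (d - 1 - m))" for a b x y :: real
  proof -
    have d: "d = Suc (m + (d - 1 - m))"
      using assms(1) by simp
    have "(b - a) ^ m * (y - x) ^ (d - 1 - m)
      = ((-1) ^ m * (a - b) ^ m) * ((-1) ^ (d - 1 - m) * (x - y) ^ (d - 1 - m))"
      by (simp flip: power_mult_distrib)
    then show ?thesis
      by (subst (2) d) (simp add: power_add)
  qed
  ultimately show ?thesis
    by (simp add: cofactor_matrix_def cofactor_vector_def block_sign_def)
qed

lemma column_sum_eq_incident_sum:
  assumes "v \<in> {1..n}" "m < d"
  shows "(\<Sum>e\<in>complete_edges n. w e * cofactor_matrix d q e (v, m))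
    = (\<Sum>j\<in>{1..n} - {v}. block_sign d v j * w {v, j}
         * (snd (q v - q j) ^ m * fst (q v - q j) ^ (d - 1 - m)))"
proof -
  let ?N = "(\<lambda>j. {v, j}) ` ({1..n} - {v})"
  have "(\<Sum>e\<in>complete_edges n. w e * cofactor_matrix d q e (v, m))
      = (\<Sum>e\<in>?N. w e * cofactor_matrix d q e (v, m))"
  proof (rule sum.mono_neutral_right[OF finite_complete_edges])
    show "?N \<subseteq> complete_edges n"
      using assms(1) by (auto intro!: doubleton_complete_edges)
    show "\<forall>e\<in>complete_edges n - ?N. w e * cofactor_matrix d q e (v, m) = 0"
    proof
      fix e assume "e \<in> complete_edges n - ?N"
      then obtain i j where e: "e = {i, j}" "i < j" "i \<in> {1..n}" "j \<in> {1..n}"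
        "Min e = i" "Max e = j" "e \<notin> ?N"
        by (auto elim: complete_edgesE)
      have "v \<noteq> i"
        using e by auto
      moreover have "v \<noteq> j"
        using e by (auto simp: insert_commute)
      ultimately show "w e * cofactor_matrix d q e (v, m) = 0"
        using e by (simp add: cofactor_matrix_def)
    qed
  qed
  also have "\<dots> = (\<Sum>j\<in>{1..n} - {v}. w {v, j} * cofactor_matrix d q {v, j} (v, m))"
    by (subst sum.reindex) (auto simp: inj_on_def doubleton_eq_iff)
  also have "\<dots> = (\<Sum>j\<in>{1..n} - {v}. block_sign d v j * w {v, j}
         * (snd (q v - q j) ^ m * fst (q v - q j) ^ (d - 1 - m)))"
  proof (rule sum.cong[OF refl])
    fix j assume "j \<in> {1..n} - {v}"
    then have "v \<noteq> j" by auto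
    then show "w {v, j} * cofactor_matrix d q {v, j} (v, m)
      = block_sign d v j * w {v, j} * (snd (q v - q j) ^ m * fst (q v - q j) ^ (d - 1 - m))"
      using cofactor_matrix_incident[OF assms(2), of v j q] by simp
  qed
  finally show ?thesis .
qed

text \<open>
  The denominator in the dependences between the vectors \<open>c\<^sub>i\<^sub>j\<close> at the vertex \<open>i\<close>.
\<close>

definition orientation_product :: "nat \<Rightarrow> (nat \<Rightarrow> real \<times> real) \<Rightarrow> nat \<Rightarrow> nat \<Rightarrow> real" where
  "orientation_product n q i j = (\<Prod>k\<in>{1..n} - {i} - {j}. orientation (q i) (q j) (q k))"

lemma orientation_product_swap:
  assumes "i \<in> {1..n}" "j \<in> {1..n}" "i \<noteq> j"
  shows "orientation_product n q j i = (-1) ^ n * orientation_product n q i j"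
proof -
  have *: "{1..n} - {j} - {i} = {1..n} - {i} - {j}"
    by auto
  have card: "n = Suc (Suc (card ({1..n} - {i} - {j})))"
    using assms by auto
  have "orientation (q j) (q i) (q k) = - 1 * orientation (q i) (q j) (q k)" for k
    by (simp add: orientation_def algebra_simps)
  then have "orientation_product n q j i
      = (- 1) ^ card ({1..n} - {i} - {j}) * orientation_product n q i j"
    by (simp only: orientation_product_def * prod.distrib prod_constant)
  also have "(- 1 :: real) ^ card ({1..n} - {i} - {j}) = (- 1) ^ n"
    by (subst (2) card) simp
  finally show ?thesis .
qed

lemma orientation_product_nonzero:
  assumes "general_position n q" "i \<in> {1..n}" "j \<in> {1..n}" "i \<noteq> j"
  shows "orientation_product n q i j \<noteq> 0"
  using assms unfolding general_position_iff orientation_product_def by auto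

text \<open>
  The value at \<open>q\<^sub>j - q\<^sub>i\<close> of the linear form \<open>g\<^sub>i\<close> attached to the vertex \<open>i\<close>.
\<close>

definition scaled_stress ::
  "nat \<Rightarrow> nat \<Rightarrow> (nat \<Rightarrow> real \<times> real) \<Rightarrow> (nat set \<Rightarrow> real) \<Rightarrow> nat \<Rightarrow> nat \<Rightarrow> real" where
  "scaled_stress n d q w i j = block_sign d i j * w {i, j} * orientation_product n q i j"

text \<open>
  Exchanging \<open>i\<close> and \<open>j\<close> changes the block sign by \<open>(-1)\<^sup>d\<close> and each of the \<open>n - 2 = d + 1\<close>
  orientations by \<open>-1\<close>. So for \<open>n = d + 3\<close> the total sign is negative whatever the parity of \<open>d\<close>.
  This says \<open>g\<^sub>i(q\<^sub>j - q\<^sub>i) = g\<^sub>j(q\<^sub>j - q\<^sub>i)\<close>, the condition for an infinitesimal motion.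
\<close>

lemma scaled_stress_antisym:
  assumes "n = d + 3" "i \<in> {1..n}" "j \<in> {1..n}" "i \<noteq> j"
  shows "scaled_stress n d q w j i = - scaled_stress n d q w i j"
proof -
  have "block_sign d j i = (-1) ^ d * block_sign d i j"
    using assms(4) by (auto simp: block_sign_def simp flip: power_mult_distrib)
  then show ?thesis
    using orientation_product_swap[OF assms(2-4)] assms(1)
    by (simp add: scaled_stress_def insert_commute power_add flip: power_mult_distrib)
qed

lemma scaled_stress_three_term:
  assumes "n = d + 3" "1 \<le> d" "general_position n q" "stress n d q w"
    and "i \<in> {1..n}" "a \<in> {1..n}" "b \<in> {1..n}" "e \<in> {1..n}" "distinct [i, a, b, e]"
  shows "scaled_stress n d q w i a * orientation (q i) (q b) (q e)
    + scaled_stress n d q w i b * orientation (q i) (q e) (q a)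
    + scaled_stress n d q w i e * orientation (q i) (q a) (q b) = 0"
proof -
  let ?J = "{1..n} - {i}" and ?u = "\<lambda>j. q i - q j" and ?c = "\<lambda>j. block_sign d i j * w {i, j}"
  have "?c a * (\<Prod>k\<in>?J - {a}. wedge (?u a) (?u k)) * wedge (?u b) (?u e)
    + ?c b * (\<Prod>k\<in>?J - {b}. wedge (?u b) (?u k)) * wedge (?u e) (?u a)
    + ?c e * (\<Prod>k\<in>?J - {e}. wedge (?u e) (?u k)) * wedge (?u a) (?u b) = 0"
  proof (rule three_term_relation)
    show "card ?J = d + 2"
      using assms(1,5) by simp
    show "wedge (?u j) (?u k) \<noteq> 0" if "j \<in> ?J" "k \<in> ?J" "j \<noteq> k" for j k
      using that assms(3,5) unfolding orientation_wedge[symmetric] general_position_iff by auto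
    show "(\<Sum>j\<in>?J. ?c j * (snd (?u j) ^ m * fst (?u j) ^ (d - 1 - m))) = 0" if "m < d" for m
      using assms(4,5) that column_sum_eq_incident_sum[OF assms(5) that, of w q]
      unfolding stress_def by simp
  qed (use assms in auto)
  then show ?thesis
    by (simp only: scaled_stress_def orientation_product_def orientation_wedge)
qed

section \<open>Rigidity of the complete graph in the plane\<close>

text \<open>
  Infinitesimal rigidity of the complete graph in the plane: a motion that fixes a triangle is
  zero. The relation at a vertex \<open>i\<close> says that \<open>D i\<close> is linear in the direction, so it vanishes at
  \<open>i\<close> as soon as it vanishes in two independent directions. Going from the corners of the triangle
  to the edges at the corners, and then to all other edges, uses this twice.
\<close>

lemma triangle_rigid:
  fixes q :: "'a \<Rightarrow> real \<times> real"
  assumes gen: "\<And>i j k. i \<in> V \<Longrightarrow> j \<in> V \<Longrightarrow> k \<in> V \<Longrightarrow> i \<noteq> j \<Longrightarrow> j \<noteq> k \<Longrightarrow> i \<noteq> k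
      \<Longrightarrow> orientation (q i) (q j) (q k) \<noteq> 0"
    and anti: "\<And>i j. i \<in> V \<Longrightarrow> j \<in> V \<Longrightarrow> i \<noteq> j \<Longrightarrow> D j i = - D i j"
    and rel: "\<And>i a b e. i \<in> V \<Longrightarrow> a \<in> V \<Longrightarrow> b \<in> V \<Longrightarrow> e \<in> V \<Longrightarrow> distinct [i, a, b, e]
      \<Longrightarrow> D i a * orientation (q i) (q b) (q e) + D i b * orientation (q i) (q e) (q a)
          + D i e * orientation (q i) (q a) (q b) = (0::real)"
    and xyz: "x \<in> V" "y \<in> V" "z \<in> V" "distinct [x, y, z]"
    and zero: "D x y = 0" "D y z = 0" "D x z = 0"
    and ij: "i \<in> V" "j \<in> V" "i \<noteq> j"
  shows "D i j = 0"
proof -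
  have spread: "D i e = 0"
    if "i \<in> V" "a \<in> V" "b \<in> V" "e \<in> V" "distinct [i, a, b, e]" "D i a = 0" "D i b = 0"
    for i a b e
    using rel[OF that(1-5)] gen[of i a b] that by auto
  have zero': "D y x = 0" "D z y = 0" "D z x = 0"
    using anti zero xyz by auto
  have vertex: "D x e = 0 \<and> D y e = 0 \<and> D z e = 0" if "e \<in> V" "e \<notin> {x, y, z}" for e
    using spread[of x y z e] spread[of y x z e] spread[of z x y e] that xyz zero zero' by auto
  then have vertex': "D e x = 0 \<and> D e y = 0 \<and> D e z = 0" if "e \<in> V" "e \<notin> {x, y, z}" for e
    using anti[of x e] anti[of y e] anti[of z e] that xyz by auto
  show ?thesis
  proof (cases "i \<in> {x, y, z} \<or> j \<in> {x, y, z}")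
    case True
    then show ?thesis
      using vertex[of j] vertex'[of i] ij zero zero' by blast
  next
    case False
    then show ?thesis
      using spread[of i x y j] vertex'[of i] ij xyz by auto
  qed
qed

text \<open>
  Both the scaled stress and the function \<open>orientation p (q i) (q j)\<close> are motions in the sense of
  \<open>triangle_rigid\<close>. The multiple is chosen to match on the edge \<open>ac\<close>, and both functions vanish on \<open>ab\<close>.
  They match on \<open>bc\<close> as well because at the vertex \<open>c\<close> they match on \<open>ca\<close> and \<open>ce\<close>.
\<close>

lemma stress_eq_multiple:
  assumes n: "n = d + 3" "1 \<le> d" and gen: "general_position n q" and w: "stress n d q w"
    and V: "a \<in> {1..n}" "b \<in> {1..n}" "c \<in> {1..n}" "e \<in> {1..n}" "distinct [a, b, c, e]"
    and zero: "w {a, b} = 0" "w {c, e} = 0"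
    and p: "orientation p (q a) (q b) = 0" "orientation p (q c) (q e) = 0"
      "orientation p (q a) (q c) \<noteq> 0"
  shows "\<exists>\<kappa>. \<forall>i\<in>{1..n}. \<forall>j\<in>{1..n}. i \<noteq> j \<longrightarrow>
    scaled_stress n d q w i j = \<kappa> * orientation p (q i) (q j)"
proof -
  define \<kappa> where "\<kappa> = scaled_stress n d q w a c / orientation p (q a) (q c)"
  define D where "D i j = scaled_stress n d q w i j - \<kappa> * orientation p (q i) (q j)" for i j
  have anti: "D j i = - D i j" if "i \<in> {1..n}" "j \<in> {1..n}" "i \<noteq> j" for i j
  proof -
    have "orientation p (q j) (q i) = - orientation p (q i) (q j)"
      by (simp add: orientation_def)
    then show ?thesis
      using scaled_stress_antisym[OF n(1) that, of q w] by (simp add: D_def)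
  qed
  have rel: "D i x * orientation (q i) (q y) (q z) + D i y * orientation (q i) (q z) (q x)
      + D i z * orientation (q i) (q x) (q y) = 0"
    if "i \<in> {1..n}" "x \<in> {1..n}" "y \<in> {1..n}" "z \<in> {1..n}" "distinct [i, x, y, z]" for i x y z
  proof -
    have "orientation p (q i) (q x) * orientation (q i) (q y) (q z)
      + orientation p (q i) (q y) * orientation (q i) (q z) (q x)
      + orientation p (q i) (q z) * orientation (q i) (q x) (q y) = 0"
      unfolding orientation_def by algebra
    then show ?thesis
      using scaled_stress_three_term[OF n gen w that] unfolding D_def by algebra
  qed
  have ab: "D a b = 0" and ce: "D c e = 0" and ac: "D a c = 0"
    using zero p by (simp_all add: D_def scaled_stress_def \<kappa>_def)
  have ca: "D c a = 0"
    using anti[of a c] ac V by auto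
  have "D c b * orientation (q c) (q e) (q a) = 0"
    using rel[of c a b e] V ca ce by auto
  moreover have "orientation (q c) (q e) (q a) \<noteq> 0"
    using gen V unfolding general_position_iff by auto
  ultimately have cb: "D c b = 0"
    by simp
  have bc: "D b c = 0"
    using anti[of c b] cb V by auto
  have "D i j = 0" if "i \<in> {1..n}" "j \<in> {1..n}" "i \<noteq> j" for i j
  proof (rule triangle_rigid[where V = "{1..n}" and q = q and D = D and x = a and y = b and z = c])
    show "orientation (q i) (q j) (q k) \<noteq> 0"
      if "i \<in> {1..n}" "j \<in> {1..n}" "k \<in> {1..n}" "i \<noteq> j" "j \<noteq> k" "i \<noteq> k" for i j k
      using that gen unfolding general_position_iff by blast
  qed (fact anti rel V(1-3) ab bc ac that | use V(5) in simp)+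
  then show ?thesis
    by (intro exI[of _ \<kappa>]) (auto simp: D_def)
qed

section \<open>Circuits from concurrent lines\<close>

text \<open>
  The stress that corresponds to the infinitesimal rotation about \<open>p\<close>.
\<close>

definition concurrent_stress ::
  "nat \<Rightarrow> (nat \<Rightarrow> real \<times> real) \<Rightarrow> real \<times> real \<Rightarrow> nat set \<Rightarrow> real" where
  "concurrent_stress n q p e =
    orientation p (q (Min e)) (q (Max e)) / orientation_product n q (Min e) (Max e)"

lemma block_sign_concurrent_stress:
  assumes "n = d + 3" "i \<in> {1..n}" "j \<in> {1..n}" "i \<noteq> j"
  shows "block_sign d i j * concurrent_stress n q p {i, j}
    = orientation p (q i) (q j) / orientation_product n q i j"
proof (cases "i < j")
  case True
  then show ?thesis
    by (simp add: block_sign_def concurrent_stress_def)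
next
  case False
  then have "j < i"
    using assms(4) by simp
  moreover have "orientation p (q j) (q i) = - orientation p (q i) (q j)"
    by (simp add: orientation_def)
  moreover have "orientation_product n q j i = - ((-1) ^ d * orientation_product n q i j)"
    using orientation_product_swap[OF assms(2-4)] assms(1) by (simp add: power_add)
  ultimately show ?thesis
    by (simp add: block_sign_def concurrent_stress_def)
qed

text \<open>
  For fixed \<open>i\<close>, the orientation of \<open>p, q\<^sub>i, q\<^sub>j\<close> is a linear form in \<open>q\<^sub>i - q\<^sub>j\<close>. Together with
  the \<open>d - 1\<close> factors of a coordinate of \<open>c\<^sub>i\<^sub>j\<close> these are \<open>d\<close> linear forms at \<open>d + 2\<close> directions, the
  number that \<open>sum_linear_forms_over_wedges_eq_0\<close> asks for.
\<close>

lemma stress_concurrent_stress: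
  assumes n: "n = d + 3" and gen: "general_position n q"
  shows "stress n d q (concurrent_stress n q p)"
  unfolding stress_def
proof
  fix c assume "c \<in> {1..n} \<times> {..<d}"
  then obtain i m where c: "c = (i, m)" "i \<in> {1..n}" "m < d"
    by auto
  let ?J = "{1..n} - {i}" and ?u = "\<lambda>j. q i - q j"
  define fs where "fs = wedge (p - q i) # replicate m snd @ replicate (d - 1 - m) fst"
  have "(\<Sum>e\<in>complete_edges n. concurrent_stress n q p e * cofactor_matrix d q e c)
    = (\<Sum>j\<in>?J. block_sign d i j * concurrent_stress n q p {i, j}
         * (snd (?u j) ^ m * fst (?u j) ^ (d - 1 - m)))"
    unfolding c(1) by (rule column_sum_eq_incident_sum[OF c(2,3)])
  also have "\<dots> = (\<Sum>j\<in>?J. (\<Prod>f\<leftarrow>fs. f (?u j)) / (\<Prod>k\<in>?J - {j}. wedge (?u j) (?u k)))"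
  proof (rule sum.cong[OF refl])
    fix j assume "j \<in> ?J"
    then have j: "j \<in> {1..n}" "i \<noteq> j"
      by auto
    have "orientation p (q i) (q j) = wedge (p - q i) (?u j)"
      by (simp add: orientation_def wedge_def algebra_simps)
    then show "block_sign d i j * concurrent_stress n q p {i, j}
         * (snd (?u j) ^ m * fst (?u j) ^ (d - 1 - m))
      = (\<Prod>f\<leftarrow>fs. f (?u j)) / (\<Prod>k\<in>?J - {j}. wedge (?u j) (?u k))"
      unfolding block_sign_concurrent_stress[OF n c(2) j] fs_def orientation_product_def
        orientation_wedge[of "q i"]
      by (simp add: prod_list_replicate)
  qed
  also have "\<dots> = 0"
  proof (rule sum_linear_forms_over_wedges_eq_0)
    show "card ?J = length fs + 2"
      using n c(2,3) by (simp add: fs_def)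
    have "linear (wedge (p - q i))"
      by (rule linearI) (simp_all add: wedge_def algebra_simps)
    moreover have "linear (fst :: real \<times> real \<Rightarrow> real)" "linear (snd :: real \<times> real \<Rightarrow> real)"
      by (simp_all add: linear_fst linear_snd)
    ultimately show "\<forall>f\<in>set fs. linear f"
      by (auto simp: fs_def)
    show "\<forall>j\<in>?J. \<forall>k\<in>?J. j \<noteq> k \<longrightarrow> wedge (?u j) (?u k) \<noteq> 0"
      using gen c(2) unfolding orientation_wedge[symmetric] general_position_iff by auto
  qed simp
  finally show "(\<Sum>e\<in>complete_edges n. concurrent_stress n q p e * cofactor_matrix d q e c) = 0" .
qed

text \<open>
  The stress with centre \<open>p\<close> has the complement of \<open>M\<close> as its support. Up to a factor
  it is the only stress that vanishes on \<open>f\<close> and \<open>g\<close>, so no nonzero stress has its support properly inside this set.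
\<close>

lemma circuit_of_concurrent_lines:
  assumes n: "n = d + 3" "1 \<le> d" and gen: "general_position n q"
    and M: "M \<subseteq> complete_edges n" "f \<in> M" "g \<in> M" "f \<inter> g = {}"
    and p: "\<And>e. e \<in> complete_edges n \<Longrightarrow> p \<in> edge_line q e \<longleftrightarrow> e \<in> M"
  shows "cofactor_circuit n d q (complete_edges n - M)"
proof -
  have on_line: "orientation p (q i) (q j) = 0 \<longleftrightarrow> {i, j} \<in> M"
    if "i \<in> {1..n}" "j \<in> {1..n}" "i \<noteq> j" for i j
    using p[OF doubleton_complete_edges[OF that]] edge_line_iff[OF gen _ that, of p] n by auto
  have stress_val: "concurrent_stress n q p e = 0 \<longleftrightarrow> e \<in> M" if "e \<in> complete_edges n" for e
    using that
  proof (rule complete_edgesE)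
    fix i j assume e: "e = {i, j}" "i < j" "i \<in> {1..n}" "j \<in> {1..n}" "Min e = i" "Max e = j"
    then show ?thesis
      using on_line[of i j] orientation_product_nonzero[OF gen, of i j]
      by (simp add: concurrent_stress_def)
  qed
  obtain a b where f: "f = {a, b}" "a \<noteq> b" "a \<in> {1..n}" "b \<in> {1..n}"
    using complete_edgesE[of f n] M by (metis less_irrefl subsetD)
  obtain c e where g: "g = {c, e}" "c \<noteq> e" "c \<in> {1..n}" "e \<in> {1..n}"
    using complete_edgesE[of g n] M by (metis less_irrefl subsetD)
  have dist: "distinct [a, b, c, e]"
    using f g M(4) by auto
  have fg: "orientation p (q a) (q b) = 0" "orientation p (q c) (q e) = 0"
    using on_line f g M by auto
  have ac: "orientation p (q a) (q c) \<noteq> 0"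
  proof
    assume 0: "orientation p (q a) (q c) = 0"
    then have "p = q a"
      using meet_at_common_point[OF _ fg(1) 0] gen f g dist
      unfolding general_position_iff by auto
    then show False
      using fg(2) gen f g dist unfolding general_position_iff by auto
  qed
  have ne: "complete_edges n - M \<noteq> {}"
    using ac on_line[of a c] doubleton_complete_edges[of a n c] f g dist by auto
  have dep: "cofactor_dependent n d q (complete_edges n - M)"
    unfolding cofactor_dependent_iff_stress[OF Diff_subset]
    using stress_concurrent_stress[OF n(1) gen, of p] stress_val ne by blast
  have indep: "\<not> cofactor_dependent n d q T" if T: "T \<subset> complete_edges n - M" for T
  proof
    assume "cofactor_dependent n d q T"
    then obtain w where w: "stress n d q w" "\<exists>e\<in>T. w e \<noteq> 0" "\<forall>e\<in>complete_edges n - T. w e = 0"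
      using T cofactor_dependent_iff_stress[of T n d q] by blast
    \<comment> \<open>\<open>w\<close> is a multiple of the stress with centre \<open>p\<close>. It vanishes on an edge \<open>e'\<close> outside \<open>T\<close>
      where that stress does not, so the multiple is zero.\<close>
    have "w {a, b} = 0" "w {c, e} = 0"
      using w(3) M T f g by auto
    then obtain \<kappa> where \<kappa>: "\<And>i j. i \<in> {1..n} \<Longrightarrow> j \<in> {1..n} \<Longrightarrow> i \<noteq> j \<Longrightarrow>
        scaled_stress n d q w i j = \<kappa> * orientation p (q i) (q j)"
      using stress_eq_multiple[OF n gen w(1) f(3,4) g(3,4) dist _ _ fg ac] by blast
    obtain e' where e': "e' \<in> complete_edges n - M" "e' \<notin> T"
      using T by blast
    then obtain i j where ij: "e' = {i, j}" "i < j" "i \<in> {1..n}" "j \<in> {1..n}"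
      by (auto elim: complete_edgesE)
    have "scaled_stress n d q w i j = 0"
      using w(3) e' ij(1) by (simp add: scaled_stress_def)
    moreover have "orientation p (q i) (q j) \<noteq> 0"
      using on_line[of i j] ij e' by auto
    ultimately have \<kappa>0: "\<kappa> = 0"
      using \<kappa>[of i j] ij by auto
    have "w h = 0" if "h \<in> T" for h
    proof -
      have "h \<in> complete_edges n"
        using that T by blast
      then obtain i j where ij: "h = {i, j}" "i < j" "i \<in> {1..n}" "j \<in> {1..n}"
        by (auto elim: complete_edgesE)
      then show ?thesis
        using \<kappa>[of i j] \<kappa>0 orientation_product_nonzero[OF gen, of i j]
        by (simp add: scaled_stress_def block_sign_def)
    qed
    then show False
      using w(2) by blast
  qed
  show ?thesis
    unfolding cofactor_circuit_def using dep indep by blast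
qed

section \<open>Crossing families and the 3-triangulation\<close>

lemma crossing_ordered:
  assumes "i < j" "a < b"
  shows "crossing {i, j} {a, b} \<longleftrightarrow> i < a \<and> a < j \<and> j < b \<or> a < i \<and> i < b \<and> b < j"
  using assms by (auto simp: crossing_def doubleton_eq_iff)

lemma not_crossing_freeI:
  assumes "i < j" "j < k" "k < l" "l < a" "a < b" "b < c" "c < d"
    and "{i, a} \<in> E" "{j, b} \<in> E" "{k, c} \<in> E" "{l, d} \<in> E"
  shows "\<not> crossing_free 4 E"
proof -
  let ?F = "{{i, a}, {j, b}, {k, c}, {l, d}}"
  have "card ?F = 4"
    using assms by (simp add: doubleton_eq_iff)
  moreover have "\<forall>e\<in>?F. \<forall>f\<in>?F. e \<noteq> f \<longrightarrow> crossing e f"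
    using assms by (simp add: crossing_ordered)
  moreover have "?F \<subseteq> E"
    using assms by simp
  ultimately show ?thesis
    unfolding crossing_free_def by blast
qed

text \<open>
  Crossing edges are disjoint, so the four edges are ordered by their smaller endpoints. For
  two of them in this order, crossing means that the larger endpoints come in the same order and
  after both smaller endpoints.
\<close>

lemma not_crossing_freeE:
  assumes "E \<subseteq> complete_edges n" "\<not> crossing_free 4 E"
  obtains i j k l a b c d
  where "i < j" "j < k" "k < l" "l < a" "a < b" "b < c" "c < d"
    and "{i, a} \<in> E" "{j, b} \<in> E" "{k, c} \<in> E" "{l, d} \<in> E"
proof -
  obtain F where F: "F \<subseteq> E" "card F = 4" "\<forall>e\<in>F. \<forall>f\<in>F. e \<noteq> f \<longrightarrow> crossing e f"
    using assms(2) unfolding crossing_free_def by blast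
  have edge: "e = {Min e, Max e} \<and> Min e < Max e" if "e \<in> F" for e
    using that F(1) assms(1) by (auto elim!: complete_edgesE[of e n])
  have cross: "Min e < Min f \<and> Min f < Max e \<and> Max e < Max f
      \<or> Min f < Min e \<and> Min e < Max f \<and> Max f < Max e"
    if "e \<in> F" "f \<in> F" "e \<noteq> f" for e f
    using F(3) that edge[of e] edge[of f]
      crossing_ordered[of "Min e" "Max e" "Min f" "Max f"] by metis
  have "inj_on Min F"
    by (rule inj_onI) (metis cross less_irrefl)
  then have "card (Min ` F) = 4" "finite (Min ` F)"
    using F(2) by (auto simp: card_image intro: card_ge_0_finite)
  then obtain h where h: "bij_betw h {..<4::nat} (Min ` F)" "strict_mono_on {..<4} h"
    using ex_bij_betw_strict_mono_card by metis
  have "\<exists>e\<in>F. Min e = h r" if "r < 4" for r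
    using bij_betwE[OF h(1)] that by (metis imageE lessThan_iff)
  then obtain g where g: "\<And>r. r < 4 \<Longrightarrow> g r \<in> F" "\<And>r. r < 4 \<Longrightarrow> Min (g r) = h r"
    by metis
  have lt: "h r < h s" if "r < s" "s < 4" for r s
    using strict_mono_onD[OF h(2), of r s] that by auto
  have c: "h s < Max (g r) \<and> Max (g r) < Max (g s)" if "r < s" "s < 4" for r s
  proof -
    have "g r \<noteq> g s"
      using g(2)[of r] g(2)[of s] lt[of r s] that by auto
    then show ?thesis
      using cross[of "g r" "g s"] g that lt[of r s] by auto
  qed
  have in_E: "{h r, Max (g r)} \<in> E" if "r < 4" for r
    using g[OF that] edge[of "g r"] F(1) by auto
  show thesis
    using lt[of 0 1] lt[of 1 2] lt[of 2 3] c[of 0 1] c[of 1 2] c[of 2 3] c[of 0 3]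
      in_E[of 0] in_E[of 1] in_E[of 2] in_E[of 3]
    by (intro that[of "h 0" "h 1" "h 2" "h 3" "Max (g 0)" "Max (g 1)" "Max (g 2)" "Max (g 3)"])
      simp_all
qed

text \<open>
  Eight increasing numbers up to 9 omit only one, so that each endpoint has two possible values.
  The omitted number is at least 8 if \<open>c = 7\<close>, between 5 and 7 if \<open>c = 8\<close> and \<open>l = 4\<close>, and at most 4
  if \<open>c = 8\<close> and \<open>l = 5\<close>.
\<close>

lemma four_crossing_contains_missing_edge:
  fixes i j k l a b c d :: nat
  assumes "1 \<le> i" "i < j" "j < k" "k < l" "l < a" "a < b" "b < c" "c < d" "d \<le> 9"
  shows "(i, a) = (1, 6) \<or> (k, c) = (3, 7) \<or> (j, b) = (3, 7) \<or> (l, d) = (4, 9)"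
proof -
  consider "c = 7" | "l = 4" "d = 9" | "c = 8" "l = 5" "d = 9"
    using assms by linarith
  then show ?thesis
  proof cases
    case 1
    then have "k = 3"
      using assms by linarith
    with 1 show ?thesis by simp
  next
    case 2
    then show ?thesis by simp
  next
    case 3
    then have "a = 6" "b = 7" "i = 1 \<or> j = 3"
      using assms by linarith+
    then show ?thesis by auto
  qed
qed

text \<open>
  Maximality: each of the three missing edges occurs in a family of four pairwise crossing edges whose
  other members belong to \<open>G\<close>.
\<close>

lemma triangulation_G: "k_triangulation 3 9 G"
  unfolding k_triangulation_def
proof (intro conjI allI impI)
  show sub: "G \<subseteq> complete_edges 9"
    by (auto simp: G_def)
  have no: "{1, 6} \<notin> G" "{3, 7} \<notin> G" "{4, 9} \<notin> G"
    by (simp_all add: G_def missing_edges_def)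
  have "crossing_free 4 G"
  proof (rule ccontr)
    assume "\<not> crossing_free 4 G"
    then obtain i j k l a b c d
      where ord: "i < j" "j < k" "k < l" "l < a" "a < b" "b < c" "c < d"
        and E: "{i, a} \<in> G" "{j, b} \<in> G" "{k, c} \<in> G" "{l, d} \<in> G"
      by (rule not_crossing_freeE[OF sub])
    have "1 \<le> i" "d \<le> 9"
      using E sub by (auto simp: complete_edges_def)
    then show False
      using four_crossing_contains_missing_edge[of i j k l a b c d] ord E no by auto
  qed
  then show "crossing_free (3 + 1) G"
    by simp
next
  fix E' assume E': "G \<subset> E' \<and> E' \<subseteq> complete_edges 9"
  have G: "{i, j} \<in> E'" if "i \<in> {1..9}" "j \<in> {1..9}" "i < j" "{i, j} \<notin> missing_edges" for i j
  proof -
    have "{i, j} \<in> complete_edges 9"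
      using that by (simp add: complete_edges_def)
    then show ?thesis
      using that(4) E' by (auto simp: G_def)
  qed
  from E' have "{1, 6} \<in> E' \<or> {3, 7} \<in> E' \<or> {4, 9} \<in> E'"
    by (auto simp: G_def missing_edges_def)
  then have "\<not> crossing_free 4 E'"
  proof (elim disjE)
    assume "{1, 6} \<in> E'"
    moreover have "{2, 7} \<in> E'" "{4, 8} \<in> E'" "{5, 9} \<in> E'"
      by (auto intro!: G simp: missing_edges_def doubleton_eq_iff)
    ultimately show ?thesis
      by (intro not_crossing_freeI[of 1 2 4 5 6 7 8 9]) simp_all
  next
    assume "{3, 7} \<in> E'"
    moreover have "{1, 5} \<in> E'" "{2, 6} \<in> E'" "{4, 8} \<in> E'"
      by (auto intro!: G simp: missing_edges_def doubleton_eq_iff)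
    ultimately show ?thesis
      by (intro not_crossing_freeI[of 1 2 3 4 5 6 7 8]) simp_all
  next
    assume "{4, 9} \<in> E'"
    moreover have "{1, 5} \<in> E'" "{2, 7} \<in> E'" "{3, 8} \<in> E'"
      by (auto intro!: G simp: missing_edges_def doubleton_eq_iff)
    ultimately show ?thesis
      by (intro not_crossing_freeI[of 1 2 3 4 5 7 8 9]) simp_all
  qed
  then show "\<not> crossing_free (3 + 1) E'"
    by simp
qed

section \<open>Convex polygons\<close>

text \<open>
  Comparing two orientations by their product treats clockwise and counterclockwise polygons
  at once.
\<close>

lemma convex_polygon_same_side:
  assumes "convex_polygon n q" "1 \<le> i" "i < j" "j < k" "k \<le> n"
    and "1 \<le> i'" "i' < j'" "j' < k'" "k' \<le> n"
  shows "orientation (q i) (q j) (q k) * orientation (q i') (q j') (q k') > 0"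
  using assms unfolding convex_polygon_def
  by (auto intro: mult_pos_pos mult_neg_neg)

lemma convex_polygon_general_position:
  assumes "convex_polygon n q"
  shows "general_position n q"
  unfolding general_position_iff
proof (intro ballI impI)
  fix i j k assume ijk: "i \<in> {1..n}" "j \<in> {1..n}" "k \<in> {1..n}" "i \<noteq> j \<and> j \<noteq> k \<and> i \<noteq> k"
  have sorted: "orientation (q a) (q b) (q c) \<noteq> 0" if "1 \<le> a" "a < b" "b < c" "c \<le> n" for a b c
    using convex_polygon_same_side[OF assms that that] by auto
  consider "i < j" "j < k" | "i < k" "k < j" | "j < i" "i < k" | "j < k" "k < i"
    | "k < i" "i < j" | "k < j" "j < i"
    using ijk(4) by linarith
  then show "orientation (q i) (q j) (q k) \<noteq> 0"
  proof cases
    case 1 then show ?thesis using sorted[of i j k] ijk by auto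
  next
    case 2 then show ?thesis using sorted[of i k j] orientation_swap[of "q i" "q j" "q k"] ijk by auto
  next
    case 3 then show ?thesis using sorted[of j i k] ijk
        orientation_rotate[of "q i" "q j" "q k"] orientation_swap[of "q j" "q k" "q i"] by auto
  next
    case 4 then show ?thesis using sorted[of j k i] orientation_rotate[of "q i" "q j" "q k"] ijk by auto
  next
    case 5 then show ?thesis using sorted[of k i j] orientation_rotate[of "q k" "q i" "q j"] ijk by auto
  next
    case 6 then show ?thesis using sorted[of k j i] ijk
        orientation_swap[of "q i" "q j" "q k"] orientation_rotate[of "q i" "q k" "q j"] by auto
  qed
qed

lemma orientation_affine:
  assumes "s + t = 1"
  shows "orientation x y (s *\<^sub>R u + t *\<^sub>R v) = s * orientation x y u + t * orientation x y v"
proof -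
  have s: "s = 1 - t"
    using assms by simp
  show ?thesis
    unfolding s orientation_def by (simp add: algebra_simps)
qed

text \<open>
  The orientation with respect to \<open>x\<close>, \<open>y\<close> is an affine function. It changes sign between \<open>u\<close> and \<open>v\<close>,
  so its zero on the line through \<open>u\<close> and \<open>v\<close> has positive barycentric coordinates.
\<close>

lemma in_open_segment_if_separated:
  assumes "p \<in> affine hull {u, v}" "orientation x y p = 0"
    and "orientation x y u * orientation x y v < 0"
  shows "p \<in> open_segment u v"
proof -
  obtain s t where p: "p = s *\<^sub>R u + t *\<^sub>R v" and st: "s + t = 1"
    using assms(1) by (auto simp: affine_hull_2)
  let ?U = "orientation x y u" and ?V = "orientation x y v"
  have 0: "s * ?U + t * ?V = 0"
    using assms(2) unfolding p orientation_affine[OF st] .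
  have s: "s = 1 - t"
    using st by simp
  have "t * (?U * ?U - ?U * ?V) = ?U * ?U" "s * (?V * ?V - ?U * ?V) = ?V * ?V"
    using 0 s by algebra+
  moreover have "0 < ?U * ?U" "0 < ?V * ?V"
    using assms(3) by (auto simp: mult_less_0_iff zero_less_mult_iff)
  ultimately have "0 < t" "0 < s"
    using assms(3) by (smt (verit) zero_less_mult_iff)+
  moreover have "u \<noteq> v"
    using assms(3) by (auto simp: mult_less_0_iff)
  ultimately show ?thesis
    unfolding in_segment p s using st by auto
qed

text \<open>
  At \<open>p\<close> the orientation is a positive combination of its values at \<open>u\<close> and \<open>v\<close>. One of these
  may be zero, which happens for edges that share an endpoint with the segment.
\<close>

lemma off_line_if_same_side:
  assumes "p \<in> open_segment u v" "0 \<le> orientation x y u * orientation x y v"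
    and "orientation x y u \<noteq> 0 \<or> orientation x y v \<noteq> 0"
  shows "orientation x y p \<noteq> 0"
proof -
  obtain t where t: "0 < t" "t < 1" "p = (1 - t) *\<^sub>R u + t *\<^sub>R v"
    using assms(1) by (auto simp: in_segment)
  have "orientation x y p = (1 - t) * orientation x y u + t * orientation x y v"
    unfolding t(3) by (rule orientation_affine) simp
  moreover have "0 < 1 - t"
    using t by simp
  ultimately show ?thesis
    using t(1) assms(2,3)
    by (smt (verit) mult_eq_0_iff mult_pos_pos zero_le_mult_iff mult_neg_pos mult_pos_neg)
qed

lemma crossing_lines_meet_in_open_segments:
  assumes conv: "convex_polygon n q" and ord: "1 \<le> i" "i < a" "a < j" "j < b" "b \<le> n"
    and p: "p \<in> edge_line q {i, j}" "p \<in> edge_line q {a, b}"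
  shows "p \<in> open_segment (q i) (q j)" "p \<in> open_segment (q a) (q b)"
proof -
  have gen: "general_position n q"
    by (rule convex_polygon_general_position[OF conv])
  have lines: "orientation (q i) (q j) p = 0" "orientation (q a) (q b) p = 0"
    using p edge_line_iff[OF gen, of i j p] edge_line_iff[OF gen, of a b p] ord
    by (simp_all add: orientation_rotate[of p])
  have hull: "p \<in> affine hull {q i, q j}" "p \<in> affine hull {q a, q b}"
    using p by (simp_all add: edge_line_def)
  have "orientation (q a) (q b) (q i) * orientation (q a) (q b) (q j) < 0"
    using convex_polygon_same_side[OF conv, of i a b a j b] ord
    by (simp add: orientation_rotate[of "q i"] orientation_swap[of "q a" "q j" "q b"])
  then show "p \<in> open_segment (q i) (q j)"
    by (rule in_open_segment_if_separated[OF hull(1) lines(2)])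
  have "orientation (q i) (q j) (q a) * orientation (q i) (q j) (q b) < 0"
    using convex_polygon_same_side[OF conv, of i a j i j b] ord
    by (simp add: orientation_swap[of "q i" "q a" "q j"])
  then show "p \<in> open_segment (q a) (q b)"
    by (rule in_open_segment_if_separated[OF hull(2) lines(1)])
qed

text \<open>
  The point \<open>p\<close> is interior to the segments \<open>16\<close>, \<open>37\<close> and \<open>49\<close>. The line of an edge that shares an
  endpoint with one of them contains no second point of that segment. The only other edges of \<open>G\<close> are \<open>25\<close>, \<open>28\<close> and
  \<open>58\<close>, and they have the segments \<open>16\<close>, \<open>37\<close> and \<open>49\<close>, respectively, strictly on one side.
\<close>

lemma convex_concurrent_point_off_other_lines:
  assumes conv: "convex_polygon 9 q" and p: "\<forall>e\<in>missing_edges. p \<in> edge_line q e"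
    and e: "e \<in> G"
  shows "p \<notin> edge_line q e"
proof -
  have gen: "general_position 9 q"
    by (rule convex_polygon_general_position[OF conv])
  have lines: "p \<in> edge_line q {1, 6}" "p \<in> edge_line q {3, 7}" "p \<in> edge_line q {4, 9}"
    using p by (simp_all add: missing_edges_def)
  have seg: "p \<in> open_segment (q 1) (q 6)" "p \<in> open_segment (q 3) (q 7)"
    "p \<in> open_segment (q 4) (q 9)"
    using crossing_lines_meet_in_open_segments[OF conv, of 1 3 6 7 p]
      crossing_lines_meet_in_open_segments[OF conv, of 1 4 6 9 p] lines by auto
  have off: "p \<notin> edge_line q {x, y}"
    if "orientation (q x) (q y) p \<noteq> 0" "x \<in> {1..9}" "y \<in> {1..9}" "x \<noteq> y" for x y
    using edge_line_iff[OF gen _ that(2-4), of p] that(1) by (simp add: orientation_rotate[of p])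
  have shared: "p \<notin> edge_line q {u, x}"
    if "p \<in> open_segment (q u) (q v)" "u \<in> {1..9}" "v \<in> {1..9}" "x \<in> {1..9}"
      "u \<noteq> v" "x \<noteq> u" "x \<noteq> v" for u v x
  proof (rule off)
    have "orientation (q u) (q x) (q v) \<noteq> 0"
      using gen that unfolding general_position_iff by auto
    moreover have "orientation (q u) (q x) (q u) = 0"
      by (simp add: orientation_def)
    ultimately show "orientation (q u) (q x) p \<noteq> 0"
      by (intro off_line_if_same_side[OF that(1)]) simp_all
  qed (use that in auto)
  have free: "p \<notin> edge_line q {x, y}"
    if "p \<in> open_segment (q u) (q v)" "x \<in> {1..9}" "y \<in> {1..9}" "x \<noteq> y"
      "orientation (q x) (q y) (q u) * orientation (q x) (q y) (q v) > 0" for x y u v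
    using that by (intro off off_line_if_same_side[OF that(1)]) auto
  obtain x y where xy: "e = {x, y}" "x < y" "x \<in> {1..9}" "y \<in> {1..9}"
    using e by (auto simp: G_def elim: complete_edgesE)
  have not_missing: "{x, y} \<noteq> {1, 6}" "{x, y} \<noteq> {3, 7}" "{x, y} \<noteq> {4, 9}"
    using e xy by (auto simp: G_def missing_edges_def)
  have end_point: "p \<notin> edge_line q {u, x}"
    if ux: "u \<in> {1, 3, 4, 6, 7, 9}" "x \<in> {1..9}" "x \<noteq> u"
      "{u, x} \<noteq> {1, 6}" "{u, x} \<noteq> {3, 7}" "{u, x} \<noteq> {4, 9}" for u x
  proof -
    have seg': "p \<in> open_segment (q 6) (q 1)" "p \<in> open_segment (q 7) (q 3)"
      "p \<in> open_segment (q 9) (q 4)"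
      using seg by (simp_all add: open_segment_commute)
    consider "u = 1" "x \<noteq> 6" | "u = 6" "x \<noteq> 1" | "u = 3" "x \<noteq> 7" | "u = 7" "x \<noteq> 3"
      | "u = 4" "x \<noteq> 9" | "u = 9" "x \<noteq> 4"
      using ux(1,4-6) by (auto simp: doubleton_eq_iff)
    then show ?thesis
      by cases (use shared[OF seg(1)] shared[OF seg(2)] shared[OF seg(3)] shared[OF seg'(1)]
          shared[OF seg'(2)] shared[OF seg'(3)] ux(2,3) in auto)
  qed
  have rest: "p \<notin> edge_line q {2, 5}" "p \<notin> edge_line q {2, 8}" "p \<notin> edge_line q {5, 8}"
  proof -
    have "orientation (q 2) (q 5) (q 1) * orientation (q 2) (q 5) (q 6) > 0"
      using convex_polygon_same_side[OF conv, of 1 2 5 2 5 6]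
        orientation_rotate[of "q 1" "q 2" "q 5"] by simp
    then show "p \<notin> edge_line q {2, 5}"
      by (intro free[OF seg(1)]) auto
    have "orientation (q 2) (q 8) (q 3) * orientation (q 2) (q 8) (q 7) > 0"
      using convex_polygon_same_side[OF conv, of 2 3 8 2 7 8]
      by (simp add: orientation_swap[of "q 2" _ "q 8"])
    then show "p \<notin> edge_line q {2, 8}"
      by (intro free[OF seg(2)]) auto
    have "orientation (q 5) (q 8) (q 4) * orientation (q 5) (q 8) (q 9) > 0"
      using convex_polygon_same_side[OF conv, of 4 5 8 5 8 9]
      by (simp add: orientation_rotate[of "q 4"])
    then show "p \<notin> edge_line q {5, 8}"
      by (intro free[OF seg(3)]) auto
  qed
  show ?thesis
  proof (cases "x \<in> {1, 3, 4, 6, 7, 9} \<or> y \<in> {1, 3, 4, 6, 7, 9}")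
    case True
    then show ?thesis
    proof
      assume "x \<in> {1, 3, 4, 6, 7, 9}"
      then show ?thesis
        using end_point[of x y] xy not_missing by simp
    next
      assume "y \<in> {1, 3, 4, 6, 7, 9}"
      then show ?thesis
        using end_point[of y x] xy not_missing by (simp add: insert_commute)
    qed
  next
    case False
    have set9: "{1..9::nat} = {1, 2, 3, 4, 5, 6, 7, 8, 9}"
      by auto
    have "x \<in> {2, 5, 8}" "y \<in> {2, 5, 8}"
      using False xy(3,4) unfolding set9 by auto
    then show ?thesis
      using rest xy(1,2) by auto
  qed
qed

lemma circuit_G:
  assumes "general_position 9 q" "\<forall>e\<in>missing_edges. p \<in> edge_line q e"
    and "\<forall>e\<in>G. p \<notin> edge_line q e"
  shows "cofactor_circuit 9 6 q G"
proof -
  have "cofactor_circuit 9 6 q (complete_edges 9 - missing_edges)"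
  proof (rule circuit_of_concurrent_lines[where f = "{1, 6}" and g = "{3, 7}" and p = p])
    show "missing_edges \<subseteq> complete_edges 9"
      by (simp add: missing_edges_def complete_edges_def)
    show "p \<in> edge_line q e \<longleftrightarrow> e \<in> missing_edges" if "e \<in> complete_edges 9" for e
      using that assms(2,3) by (auto simp: G_def)
  qed (use assms in \<open>simp_all add: missing_edges_def\<close>)
  then show ?thesis
    by (simp add: G_def)
qed

text \<open>
  The orientation of three points on the parabola is a Vandermonde determinant.
\<close>

lemma parabola_convex_polygon:
  fixes t :: "nat \<Rightarrow> real"
  assumes "\<And>i. i \<in> {1..n} \<Longrightarrow> q i = (t i, (t i)\<^sup>2)" and "strict_mono_on {1..n} t"
  shows "convex_polygon n q"
  unfolding convex_polygon_def
proof (intro disjI1 allI impI)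
  fix i j k assume ijk: "1 \<le> i \<and> i < j \<and> j < k \<and> k \<le> n"
  then have "t i < t j" "t j < t k"
    using strict_mono_onD[OF assms(2)] by auto
  then have "0 < (t j - t i) * ((t k - t i) * (t k - t j))"
    by simp
  also have "\<dots> = orientation (q i) (q j) (q k)"
    using ijk assms(1) by (simp add: orientation_def power2_eq_square algebra_simps)
  finally show "0 < orientation (q i) (q j) (q k)" .
qed

theorem theorem1p8:
  shows "k_triangulation 3 9 G \<and>
    (\<forall>q p. general_position 9 q \<and> (\<forall>e\<in>missing_edges. p \<in> edge_line q e)
            \<and> (\<forall>e\<in>G. p \<notin> edge_line q e)
        \<longrightarrow> cofactor_circuit 9 6 q G) \<and>
    (\<forall>q. convex_polygon 9 q \<and> (\<exists>p. \<forall>e\<in>missing_edges. p \<in> edge_line q e)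
        \<longrightarrow> cofactor_circuit 9 6 q G) \<and>
    (\<forall>q. (\<forall>i\<in>{1..9}. q i = (real i, (real i)\<^sup>2))
        \<longrightarrow> (\<exists>p. \<forall>e\<in>missing_edges. p \<in> edge_line q e) \<and> cofactor_circuit 9 6 q G)"
proof -
  have convex: "cofactor_circuit 9 6 q G"
    if "convex_polygon 9 q" "\<forall>e\<in>missing_edges. p \<in> edge_line q e" for q p
    using circuit_G[OF convex_polygon_general_position[OF that(1)] that(2)]
      convex_concurrent_point_off_other_lines[OF that] by blast
  \<comment> \<open>The three lines are \<open>y = 7 x - 6\<close>, \<open>y = 10 x - 21\<close> and \<open>y = 13 x - 36\<close>; they meet in \<open>(5, 29)\<close>.\<close>
  have parabola: "convex_polygon 9 q \<and> (\<forall>e\<in>missing_edges. (5, 29) \<in> edge_line q e)"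
    if q: "\<forall>i\<in>{1..9}. q i = (real i, (real i)\<^sup>2)" for q
  proof
    show conv: "convex_polygon 9 q"
      using q by (intro parabola_convex_polygon[where t = real]) (auto simp: strict_mono_on_def)
    have vals: "q 1 = (1, 1)" "q 3 = (3, 9)" "q 4 = (4, 16)" "q 6 = (6, 36)"
      "q 7 = (7, 49)" "q 9 = (9, 81)"
      using q by auto
    show "\<forall>e\<in>missing_edges. (5, 29) \<in> edge_line q e"
      by (simp add: missing_edges_def vals vals(1)[simplified] orientation_def
          edge_line_iff[OF convex_polygon_general_position[OF conv]])
  qed
  show ?thesis
    using triangulation_G circuit_G convex parabola by blast
qed

end
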